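(* As $n \to \infty$ over the positive integers, $q(n) \leq (1+o(1)) \frac{e \ln 2}{8} n^2$.
   Context: A hypergraph $H=(V,E)$ is a finite vertex set $V$ together with a set $E$ of edges, each edge being a subset of $V$ with at least two vertices. A 2-colouring of $H$ assigns one of two colours to each vertex; it is proper if no edge is monochromatic, and $H$ is 2-colourable if it has a proper 2-colouring. For a hypergraph $H=(V,E)$ define $q(H) = \sum_{e\in E} 2^{-|e|}$. For a positive integer $n$, $q(n)$ denotes the minimum of $q(H)$ over all hypergraphs $H$ that are not 2-colourable and whose smallest edge has exactly $n$ vertices. Here $e$ is Euler's number and $\ln$ is the natural logarithm. *)

theory Defs
  imports Complex_Main
begin

definition hypergraph :: "'a set \<Rightarrow> 'a set set \<Rightarrow> bool" where
  "hypergraph V E \<longleftrightarrow> finite V \<and> (\<forall>e\<in>E. e \<subseteq> V \<and> 2 \<le> card e)"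

definition proper_2colouring :: "'a set set \<Rightarrow> ('a \<Rightarrow> bool) \<Rightarrow> bool" where
  "proper_2colouring E f \<longleftrightarrow> (\<forall>e\<in>E. \<exists>x\<in>e. \<exists>y\<in>e. f x \<noteq> f y)"

definition two_colourable :: "'a set \<Rightarrow> 'a set set \<Rightarrow> bool" where
  "two_colourable V E \<longleftrightarrow> (\<exists>f::'a \<Rightarrow> bool. proper_2colouring E f)"

definition qH :: "'a set set \<Rightarrow> real" where
  "qH E = (\<Sum>e\<in>E. (1/2) ^ card e)"

text \<open>q(n): minimum (infimum) of q(H) over non-2-colourable hypergraphs whose smallest edge
  has exactly n vertices. Vertices are taken from nat (every finite hypergraph is isomorphic
  to one on a subset of nat).\<close>
definition q :: "nat \<Rightarrow> real" where
  "q n = Inf {qH E | (V :: nat set) E. hypergraph V E \<and> \<not> two_colourable V E \<and>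
                 E \<noteq> {} \<and> Min (card ` E) = n}"

end

theory Submission
  imports Defs "HOL-Real_Asymp.Real_Asymp"
begin

text \<open>
  Let \<open>V\<close> have \<open>2k\<close> vertices with \<open>k\<close> about \<open>n\<^sup>2/4\<close>. Every 2-colouring of \<open>V\<close> makes at
  least a proportion \<open>p = 2 (k choose n) / (2k choose n)\<close> of the \<open>n\<close>-subsets monochromatic, so
  picking \<open>n\<close>-subsets greedily leaves at most \<open>exp (-pm) 2\<^sup>2\<^sup>k\<close> colourings proper after \<open>m\<close>
  steps. One does not have to continue until none is left: once at most \<open>2\<^sup>k\<close> remain, each of
  them is destroyed by adding its larger colour class as an edge, at a total cost of at most
  \<open>2\<^sup>k 2\<^sup>-\<^sup>k = 1\<close>. Stopping at \<open>2\<^sup>k\<close> instead of \<open>1\<close> halves the number of \<open>n\<close>-edges, which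
  gives the constant \<open>e ln 2 / 8\<close> in place of Erdos's \<open>e ln 2 / 4\<close>.
\<close>

section \<open>Greedy covering\<close>

text \<open>Double counting the pairs with \<open>R e c\<close> over the still uncovered
  \<open>c\<close> shows that some \<open>e\<close> in \<open>A\<close> hits at least a proportion
  \<open>p\<close> of them. Adding it to \<open>F\<close> multiplies the uncovered part by at most
  \<open>1 - p\<close>, hence by at most \<open>exp (- p)\<close>.\<close>

lemma greedy_cover:
  fixes R :: "'e \<Rightarrow> 'c \<Rightarrow> bool" and p :: real
  assumes A: "finite A" "A \<noteq> {}" and C: "finite C"
    and p: "\<And>c. c \<in> C \<Longrightarrow> p * card A \<le> card {e \<in> A. R e c}"
  shows "\<exists>F\<subseteq>A. card F \<le> m \<and>
           card {c \<in> C. \<forall>e\<in>F. \<not> R e c} \<le> exp (- (p * m)) * card C"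
proof (induction m)
  case 0
  show ?case by (rule exI[of _ "{}"]) simp
next
  case (Suc m)
  then obtain F where F: "F \<subseteq> A" "card F \<le> m"
    and U_le: "card {c \<in> C. \<forall>e\<in>F. \<not> R e c} \<le> exp (- (p * m)) * card C"
    by blast
  define U where "U = {c \<in> C. \<forall>e\<in>F. \<not> R e c}"
  have U: "finite U" "U \<subseteq> C" using C by (auto simp: U_def)
  obtain e where e: "e \<in> A" and hit: "p * card U \<le> card {c \<in> U. R e c}"
  proof (rule ccontr)
    assume "\<not> thesis"
    with that have lt: "\<And>e. e \<in> A \<Longrightarrow> card {c \<in> U. R e c} < p * card U"
      by fastforce
    have "card U * (p * card A) = (\<Sum>c\<in>U. p * card A)" by simp
    also have "\<dots> \<le> (\<Sum>c\<in>U. real (card {e \<in> A. R e c}))"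
      using U(2) by (intro sum_mono p) auto
    also have "\<dots> = (\<Sum>c\<in>U. \<Sum>e\<in>A. if R e c then 1 else 0)"
      using A(1) by (simp add: sum.If_cases Int_def)
    also have "\<dots> = (\<Sum>e\<in>A. \<Sum>c\<in>U. if R e c then 1 else 0)"
      by (rule sum.swap)
    also have "\<dots> = (\<Sum>e\<in>A. real (card {c \<in> U. R e c}))"
      using U(1) by (simp add: sum.If_cases Int_def)
    also have "\<dots> < (\<Sum>e\<in>A. p * card U)"
      by (intro sum_strict_mono A lt)
    also have "\<dots> = card U * (p * card A)" by simp
    finally show False by simp
  qed
  have split: "{c \<in> C. \<forall>e'\<in>insert e F. \<not> R e' c} = U - {c \<in> U. R e c}"
    by (auto simp: U_def)
  have "real (card (U - {c \<in> U. R e c})) = real (card U) - real (card {c \<in> U. R e c})"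
    using U(1) by (subst card_Diff_subset) (auto intro!: of_nat_diff card_mono)
  also have "\<dots> \<le> (1 - p) * card U" using hit by (simp add: algebra_simps)
  also have "\<dots> \<le> exp (- p) * card U"
    using exp_ge_add_one_self[of "- p"] by (intro mult_right_mono) auto
  also have "\<dots> \<le> exp (- p) * (exp (- (p * m)) * card C)"
    using U_le by (intro mult_left_mono) (auto simp: U_def)
  also have "\<dots> = exp (- (p * Suc m)) * card C"
    by (simp add: exp_add[symmetric] algebra_simps)
  finally have "card {c \<in> C. \<forall>e'\<in>insert e F. \<not> R e' c} \<le> exp (- (p * Suc m)) * card C"
    by (simp only: split)
  moreover have "card (insert e F) \<le> Suc m"
    using F(2) card_insert_le_m1[of "Suc m" F e] by simp
  ultimately show ?case using F(1) e by (intro exI[of _ "insert e F"]) auto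
qed

section \<open>Binomial estimates\<close>

text \<open>Discrete convexity. For \<open>n = Suc l\<close>, Pascal's rule shows that passing from
  \<open>i\<close> to \<open>Suc i\<close> adds \<open>(k + i) choose l\<close> and removes
  \<open>(k - Suc i) choose l\<close>, which is no larger.\<close>

lemma binomial_midpoint_aux:
  "2 * (k choose n) \<le> ((k + i) choose n) + ((k - i) choose n)" if "i \<le> k" for i k n :: nat
  using that
proof (induction i)
  case 0
  then show ?case by simp
next
  case (Suc i)
  show ?case
  proof (cases n)
    case 0
    then show ?thesis by simp
  next
    case (Suc l)
    define j where "j = k - Suc i"
    have j: "k - i = Suc j" using Suc.prems by (simp add: j_def)
    have "j choose l \<le> (k + i) choose l" by (rule binomial_right_mono) (simp add: j_def)
    then show ?thesis
      using Suc.IH Suc.prems j by (simp add: Suc flip: j_def)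
  qed
qed

lemma binomial_midpoint:
  fixes a b k n :: nat
  assumes "a + b = 2 * k"
  shows "2 * (k choose n) \<le> (a choose n) + (b choose n)"
proof (cases "a \<le> k")
  case True
  then have "k - a \<le> k" "k + (k - a) = b" "k - (k - a) = a" using assms by auto
  then show ?thesis using binomial_midpoint_aux[of "k - a" k n] by simp
next
  case False
  then have "k - b \<le> k" "k + (k - b) = a" "k - (k - b) = b" using assms by auto
  then show ?thesis using binomial_midpoint_aux[of "k - b" k n] by simp
qed

text \<open>Factor by factor, \<open>(2k - i) / (k - i) = 2 (1 + i / (2 (k - i)))\<close>, and
  \<open>k - i\<close> is at least \<open>d = k - n\<close>. So each factor is at most
  \<open>2 exp (i / (2d))\<close>, and the exponents add up to at most
  \<open>n^2 / (4d)\<close>.\<close>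

lemma binomial_double_le:
  assumes "n < k"
  shows "real ((2 * k) choose n) \<le> 2 ^ n * exp (real n ^ 2 / (4 * (real k - real n))) * real (k choose n)"
proof -
  define d where "d = real k - real n"
  have d: "d > 0" using assms by (simp add: d_def)
  have factor: "real (2 * k - i) \<le> 2 * exp (real i / (2 * d)) * real (k - i)" if "i < n" for i
  proof -
    have i: "d \<le> real k - real i" "real (k - i) = real k - real i"
        "real (2 * k - i) = 2 * real k - real i"
      using that assms by (auto simp: d_def of_nat_diff)
    then have pos: "real k - real i > 0" using d by simp
    have "2 * real k - real i = 2 * (1 + real i / (2 * (real k - real i))) * (real k - real i)"
      using pos by (simp add: field_simps)
    also have "\<dots> \<le> 2 * (1 + real i / (2 * d)) * (real k - real i)"
      using pos i(1) d by (intro mult_right_mono mult_left_mono add_left_mono divide_left_mono) auto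
    also have "\<dots> \<le> 2 * exp (real i / (2 * d)) * (real k - real i)"
      using pos by (intro mult_right_mono mult_left_mono exp_ge_add_one_self) auto
    finally show ?thesis using i by simp
  qed
  have gauss: "(\<Sum>i=0..<n. real i) \<le> real n ^ 2 / 2"
    by (induction n) (auto simp: power2_eq_square field_simps)
  have "real ((2 * k) choose n) = (\<Prod>i=0..<n. real (2 * k - i) / real (n - i))"
    using assms by (intro binomial_altdef_of_nat) simp
  also have "\<dots> \<le> (\<Prod>i=0..<n. 2 * exp (real i / (2 * d)) * (real (k - i) / real (n - i)))"
  proof (intro prod_mono conjI)
    fix i assume "i \<in> {0..<n}"
    then have "real (2 * k - i) / real (n - i) \<le> 2 * exp (real i / (2 * d)) * real (k - i) / real (n - i)"
      by (intro divide_right_mono factor) auto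
    then show "real (2 * k - i) / real (n - i) \<le> 2 * exp (real i / (2 * d)) * (real (k - i) / real (n - i))"
      by simp
  qed auto
  also have "\<dots> = 2 ^ n * exp (\<Sum>i=0..<n. real i / (2 * d)) * (\<Prod>i=0..<n. real (k - i) / real (n - i))"
    by (simp only: prod.distrib exp_sum finite_atLeastLessThan prod_constant card_atLeastLessThan diff_zero)
  also have "(\<Prod>i=0..<n. real (k - i) / real (n - i)) = real (k choose n)"
    using assms by (intro binomial_altdef_of_nat[symmetric]) simp
  also have "(\<Sum>i=0..<n. real i / (2 * d)) = (\<Sum>i=0..<n. real i) / (2 * d)"
    by (simp add: sum_divide_distrib)
  also have "2 ^ n * exp ((\<Sum>i=0..<n. real i) / (2 * d)) * real (k choose n)
      \<le> 2 ^ n * exp (real n ^ 2 / (4 * d)) * real (k choose n)"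
    using divide_right_mono[OF gauss, of "2 * d"] d
    by (intro mult_right_mono mult_left_mono) auto
  finally show ?thesis by (simp add: d_def)
qed

section \<open>Construction of the hypergraph\<close>

text \<open>A 2-colouring is encoded by one class \<open>S\<close>, the other being
  \<open>V - S\<close>; by convexity the balanced colouring is the worst case. With
  \<open>n > 0\<close> no subset lies in both classes, so the two counts add.\<close>

lemma card_monochromatic_subsets:
  assumes V: "finite V" "card V = 2 * k" and S: "S \<subseteq> V" and "n > 0"
  shows "2 * (k choose n) \<le> card {e \<in> {e. e \<subseteq> V \<and> card e = n}. e \<subseteq> S \<or> e \<subseteq> V - S}"
proof -
  have fin: "finite S" "finite (V - S)" using V S by (auto intro: finite_subset)
  have eq: "{e \<in> {e. e \<subseteq> V \<and> card e = n}. e \<subseteq> S \<or> e \<subseteq> V - S}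
      = {e. e \<subseteq> S \<and> card e = n} \<union> {e. e \<subseteq> V - S \<and> card e = n}"
    using S by auto
  have disj: "{e. e \<subseteq> S \<and> card e = n} \<inter> {e. e \<subseteq> V - S \<and> card e = n} = {}"
  proof (rule equals0I)
    fix e assume "e \<in> {e. e \<subseteq> S \<and> card e = n} \<inter> {e. e \<subseteq> V - S \<and> card e = n}"
    then have "e = {}" "card e = n" by blast+
    then show False using \<open>n > 0\<close> by simp
  qed
  have fin_subsets: "finite {e. e \<subseteq> T \<and> card e = n}" if "finite T" for T
    using that by (rule finite_subset[rotated, OF finite_Pow_iff[THEN iffD2]]) blast
  have "card S + card (V - S) = 2 * k"
    using card_Diff_subset[OF fin(1) S] card_mono[OF V(1) S] V(2) by linarith
  from binomial_midpoint[OF this, of n] show ?thesis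
    unfolding eq card_Un_disjoint[OF fin_subsets[OF fin(1)] fin_subsets[OF fin(2)] disj]
      n_subsets[OF fin(1)] n_subsets[OF fin(2)] .
qed

lemma q_le:
  fixes V :: "nat set"
  assumes "hypergraph V E" "\<not> two_colourable V E" "E \<noteq> {}" "Min (card ` E) = n"
  shows "q n \<le> qH E"
  unfolding q_def
proof (rule cInf_lower)
  show "bdd_below {qH E |(V :: nat set) E. hypergraph V E \<and> \<not> two_colourable V E \<and>
                 E \<noteq> {} \<and> Min (card ` E) = n}"
    by (rule bdd_belowI[of _ 0]) (auto simp: qH_def intro!: sum_nonneg)
qed (use assms in auto)

lemma q_bound:
  assumes n: "2 \<le> n" "n < k"
  shows "q n \<le> k * (ln 2 / 2) * exp (real n ^ 2 / (4 * (real k - real n))) + 3"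
proof -
  define V where "V = {..<2 * k}"
  define A where "A = {e. e \<subseteq> V \<and> card e = n}"
  define R where "R = (\<lambda>e S. e \<subseteq> S \<or> e \<subseteq> V - S)"
  define p where "p = 2 * real (k choose n) / real ((2 * k) choose n)"
  \<comment> \<open>The least \<open>m\<close> with \<open>exp (- (p * m))\<close> at most
    \<open>2^-k\<close>, so that at most \<open>2^k\<close> of the \<open>2^(2k)\<close> colourings
    survive.\<close>
  define m where "m = nat \<lceil>k * ln 2 / p\<rceil>"
  have V: "finite V" "card V = 2 * k" by (auto simp: V_def)
  have cardA: "card A = (2 * k) choose n" using V by (simp add: A_def n_subsets)
  have finA: "finite A" using V by (simp add: A_def)
  have choose_pos: "k choose n > 0" "(2 * k) choose n > 0" using n by auto
  then have A_ne: "A \<noteq> {}" using cardA by fastforce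
  have p: "p > 0" using choose_pos by (simp add: p_def)
  have "p * card A \<le> card {e \<in> A. R e S}" if "S \<in> Pow V" for S
  proof -
    have "p * card A = real (2 * (k choose n))" using choose_pos cardA by (simp add: p_def)
    also have "\<dots> \<le> card {e \<in> A. R e S}"
      using card_monochromatic_subsets[OF V, of S n] that n by (simp add: A_def R_def)
    finally show ?thesis .
  qed
  then obtain F where F: "F \<subseteq> A" "card F \<le> m"
    and rest: "card {S \<in> Pow V. \<forall>e\<in>F. \<not> R e S} \<le> exp (- (p * m)) * card (Pow V)"
    using greedy_cover[of A "Pow V" p R m] finA A_ne V by auto
  define U where "U = {S \<in> Pow V. \<forall>e\<in>F. \<not> R e S}"
  have finU: "finite U" using V by (simp add: U_def)
  have "k * ln 2 / p \<le> m" unfolding m_def by linarith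
  then have "k * ln 2 \<le> p * m" using p by (simp add: field_simps)
  then have "exp (- (p * m)) \<le> exp (- (k * ln 2))" by simp
  also have "exp (- (k * ln 2)) = (1 / 2) ^ k"
    by (simp only: exp_minus exp_of_nat_mult) (simp add: power_one_over inverse_eq_divide)
  finally have "card U \<le> (1 / 2) ^ k * card (Pow V)"
    using rest by (intro order.trans[OF rest[folded U_def] mult_right_mono]) auto
  also have "\<dots> = 2 ^ k"
    using V by (simp add: card_Pow mult_2 power_add power_one_over)
  finally have cardU: "real (card U) \<le> 2 ^ k" .

  define big where "big = (\<lambda>S. if k \<le> card S then S else V - S)"
  have big: "big S \<subseteq> V" "k \<le> card (big S)" if "S \<in> U" for S
  proof -
    have "S \<subseteq> V" using that by (simp add: U_def)
    moreover from this have "card (V - S) = 2 * k - card S"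
      using V by (simp add: card_Diff_subset finite_subset)
    ultimately show "big S \<subseteq> V" "k \<le> card (big S)" by (auto simp: big_def)
  qed
  \<comment> \<open>This edge attains the minimum size \<open>n\<close> whether or not
    \<open>F\<close> is empty; the edges \<open>big S\<close> have at least \<open>k > n\<close>
    vertices.\<close>
  define e0 where "e0 = {..<n}"
  have e0: "e0 \<subseteq> V" "card e0 = n" using n by (auto simp: e0_def V_def)
  define E where "E = insert e0 F \<union> big ` U"
  have finF: "finite F" using F finA finite_subset by blast
  have finE: "finite E" using finF finU by (simp add: E_def)
  have size: "e \<subseteq> V \<and> n \<le> card e" if "e \<in> E" for e
    using that e0 F(1) big n by (fastforce simp: E_def A_def)
  have hyp: "hypergraph V E"
    unfolding hypergraph_def using V size n by fastforce
  have "n \<in> card ` E"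
    using e0(2) by (intro image_eqI[where x = e0]) (auto simp: E_def)
  then have "Min (card ` E) = n"
    using finE size by (intro Min_eqI) auto
  moreover have "\<not> two_colourable V E"
  proof
    assume "two_colourable V E"
    then obtain f :: "nat \<Rightarrow> bool" where f: "\<And>e. e \<in> E \<Longrightarrow> \<exists>x\<in>e. \<exists>y\<in>e. f x \<noteq> f y"
      unfolding two_colourable_def proper_2colouring_def by blast
    \<comment> \<open>If \<open>f\<close> were proper, its class \<open>S\<close> would survive
      \<open>F\<close> and lie in \<open>U\<close>. But then \<open>big S\<close>, which is
      \<open>S\<close> or \<open>V - S\<close>, is a monochromatic edge.\<close>
    define S where "S = {x \<in> V. f x}"
    have not_mono: "\<not> R e S" if "e \<in> E" for e
      using f[OF that] by (auto simp: R_def S_def)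
    then have "S \<in> U" by (auto simp: U_def E_def S_def)
    moreover from this have "\<not> R (big S) S" by (intro not_mono) (simp add: E_def)
    ultimately show False by (auto simp: R_def big_def split: if_splits)
  qed
  ultimately have "q n \<le> qH E"
    using hyp by (intro q_le) (auto simp: E_def)
  also have "\<dots> \<le> (\<Sum>e\<in>insert e0 F. (1 / 2) ^ card e) + (\<Sum>e\<in>big ` U. (1 / 2) ^ card e)"
    unfolding qH_def E_def using finF finU
    by (subst sum_Un) (auto intro!: sum_nonneg)
  also have "(\<Sum>e\<in>big ` U. (1 / 2 :: real) ^ card e) \<le> 1"
  proof -
    have "(\<Sum>e\<in>big ` U. (1 / 2 :: real) ^ card e) \<le> (\<Sum>e\<in>big ` U. (1 / 2) ^ k)"
      using big by (intro sum_mono power_decreasing) auto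
    also have "\<dots> = card (big ` U) * (1 / 2) ^ k" by simp
    also have "\<dots> \<le> 2 ^ k * (1 / 2) ^ k"
      using cardU card_image_le[OF finU, of big] by (intro mult_right_mono) auto
    finally show ?thesis by (simp add: power_one_over)
  qed
  also have "(\<Sum>e\<in>insert e0 F. (1 / 2 :: real) ^ card e) \<le> m * (1 / 2) ^ n + 1"
  proof -
    have "(\<Sum>e\<in>insert e0 F. (1 / 2 :: real) ^ card e) = (\<Sum>e\<in>insert e0 F. (1 / 2) ^ n)"
      using e0 F(1) by (intro sum.cong) (auto simp: A_def)
    also have "\<dots> \<le> (m + 1) * (1 / 2) ^ n"
      using F(2) card_insert_le_m1[of "m + 1" F e0]
      by (simp only: sum_constant) (intro mult_right_mono, auto)
    also have "\<dots> \<le> m * (1 / 2) ^ n + 1"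
      by (simp add: algebra_simps power_le_one)
    finally show ?thesis .
  qed
  also have "m * (1 / 2 :: real) ^ n \<le> k * (ln 2 / 2) * exp (real n ^ 2 / (4 * (real k - real n))) + 1"
  proof -
    \<comment> \<open>The factor \<open>2 ^ n\<close> here cancels against the weight
      \<open>(1 / 2) ^ n\<close> of an \<open>n\<close>-edge.\<close>
    have "1 / p \<le> 2 ^ n * exp (real n ^ 2 / (4 * (real k - real n))) / 2"
      using binomial_double_le[OF n(2)] choose_pos by (simp add: p_def field_simps)
    then have "k * ln 2 * (1 / p)
        \<le> k * ln 2 * (2 ^ n * exp (real n ^ 2 / (4 * (real k - real n))) / 2)"
      by (intro mult_left_mono) auto
    moreover have "m \<le> k * ln 2 * (1 / p) + 1"
      using p unfolding m_def by (simp add: of_nat_nat)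
    ultimately have "m \<le> k * ln 2 * (2 ^ n * exp (real n ^ 2 / (4 * (real k - real n))) / 2) + 1"
      by linarith
    then have "m * (1 / 2 :: real) ^ n \<le>
        (k * ln 2 * (2 ^ n * exp (real n ^ 2 / (4 * (real k - real n))) / 2) + 1) * (1 / 2) ^ n"
      by (intro mult_right_mono) auto
    also have "\<dots> = k * (ln 2 / 2) * exp (real n ^ 2 / (4 * (real k - real n))) + (1 / 2) ^ n"
      by (simp add: power_one_over field_simps)
    also have "(1 / 2 :: real) ^ n \<le> 1" by (simp add: power_le_one)
    finally show ?thesis by simp
  qed
  finally show ?thesis by simp
qed

section \<open>Choice of \<open>k\<close> and the limit\<close>

theorem theorem1:
  shows "\<forall>\<epsilon>>0. \<forall>\<^sub>F n in sequentially.
           q n \<le> (1 + \<epsilon>) * (exp 1 * ln 2 / 8) * (real n)^2"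
proof (intro allI impI)
  fix \<epsilon> :: real assume "\<epsilon> > 0"
  \<comment> \<open>The bound of \<open>q_bound\<close> with \<open>k\<close> replaced by
    \<open>n^2/4 + 1\<close> in the factor and by \<open>n^2/4\<close> in the exponent. The exponent
    tends to 1, which produces Euler's number.\<close>
  define g where "g = (\<lambda>n. (real n ^ 2 / 4 + 1) * (ln 2 / 2)
      * exp (real n ^ 2 / (real n ^ 2 - 4 * real n)) + 3)"
  have "(\<lambda>n. g n / (exp 1 * ln 2 / 8 * real n ^ 2)) \<longlonglongrightarrow> 1"
    unfolding g_def by real_asymp
  then have "\<forall>\<^sub>F n in sequentially. g n / (exp 1 * ln 2 / 8 * real n ^ 2) < 1 + \<epsilon>"
    using \<open>\<epsilon> > 0\<close> by (intro order_tendstoD(2)) auto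
  then show "\<forall>\<^sub>F n in sequentially. q n \<le> (1 + \<epsilon>) * (exp 1 * ln 2 / 8) * (real n)^2"
    using eventually_gt_at_top[of 4]
  proof eventually_elim
    case (elim n)
    \<comment> \<open>\<open>k exp (n^2 / (4k))\<close> is minimal at \<open>k = n^2/4\<close>; the
      added 1 keeps \<open>n^2 \<le> 4k\<close> despite the rounding in \<open>div\<close>.\<close>
    define k where "k = n ^ 2 div 4 + 1"
    have "4 * k \<le> n ^ 2 + 4" "n ^ 2 \<le> 4 * k" by (auto simp: k_def)
    then have "real (4 * k) \<le> real (n ^ 2 + 4)" "real (n ^ 2) \<le> real (4 * k)"
      by (simp_all only: of_nat_le_iff)
    then have k: "4 * real k \<le> real n ^ 2 + 4" "real n ^ 2 \<le> 4 * real k" by simp_all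
    have pos: "real n ^ 2 - 4 * real n > 0"
      using elim(2) by (simp add: power2_eq_square)
    with k have nk: "n < k" by linarith
    have "q n \<le> k * (ln 2 / 2) * exp (real n ^ 2 / (4 * (real k - real n))) + 3"
      using elim(2) nk by (intro q_bound) auto
    also have "\<dots> \<le> g n"
    proof -
      have "real n ^ 2 - 4 * real n \<le> 4 * (real k - real n)" using k by simp
      then have "real n ^ 2 / (4 * (real k - real n)) \<le> real n ^ 2 / (real n ^ 2 - 4 * real n)"
        using pos nk by (intro divide_left_mono) auto
      moreover have "real k \<le> real n ^ 2 / 4 + 1" using k by simp
      ultimately show ?thesis
        unfolding g_def by (intro add_right_mono mult_mono) auto
    qed
    also have "g n < (1 + \<epsilon>) * (exp 1 * ln 2 / 8 * real n ^ 2)"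
      using elim(1) by (rule pos_divide_less_eq[THEN iffD1, rotated]) (use elim(2) in simp)
    finally show ?case by (simp add: mult.assoc)
  qed
qed

end
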